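(* In the setting fixed in the context (in particular, the structural condition (A) holds with constants $\tau,\sigma>0$, all $g_i$, $i\in[2n]$, and $h_j$, $j\in[2m]$, are convex, and the relaxation is built from the uniform density on $[0,1]$), let $0<\mu<\bar\mu_1$, where $$\bar\mu_1=\min\Big\{\tau,\frac{\lambda\sigma}{L_{c,1}}\Big\},\qquad\lambda=\min\{\lambda_1,\lambda_2\}.$$ If $(x^*,y^* )\in X\times Y$ is a weak d-stationary point of $\min_{x\in X}\max_{y\in Y}f^R(x,y,\mu)$, then it is a $\mu$-strong local saddle point of $\min_{x\in X}\max_{y\in Y}f(x,y)$.
   Context: Notation. $[k]=\{1,\dots,k\}$; $e_i$ is the $i$-th standard unit vector; $\mathbf{B}(z,\delta)$ is the closed ball with center $z$ and radius $\delta$; $t_+=\max\{t,0\}$; $(t_+)^0=1$ if $t>0$ and $(t_+)^0=0$ if $t\le0$; $\mathcal{N}_\Omega(x)$ is the normal cone of a closed convex set $\Omega$ at $x$; $\partial$ is the Clarke subdifferential ($\partial_x c(\bar x,\bar y)$ is that of $c(\cdot,\bar y)$ at $\bar x$, $\partial_y c(\bar x,\bar y)$ that of $c(\bar x,\cdot)$ at $\bar y$); for a set $S$, $\|S\|_\infty=\sup_{s\in S}\|s\|_\infty$. Data. $c:\mathbb{R}^n\times\mathbb{R}^m\to\mathbb{R}$ is Lipschitz continuous, convex in $x$ for each $y$ and concave in $y$ for each $x$; $g_1,\dots,g_{2n},h_1,\dots,h_{2m}:\mathbb{R}\to\mathbb{R}$ are continuously differentiable and convex; $\lambda_1,\lambda_2>0$.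 $X=\tilde X\cap\bar X$ and $Y=\tilde Y\cap\bar Y$ have nonempty interior, where $\tilde X=\{x\in\mathbb{R}^n:\underline{\mathbf u}\le x\le\overline{\mathbf u}\}$, $\tilde Y=\{y\in\mathbb{R}^m:\underline{\mathbf v}\le y\le\overline{\mathbf v}\}$ with $\underline{\mathbf u}<\overline{\mathbf u}$, $\underline{\mathbf v}<\overline{\mathbf v}$ (componentwise), and $\bar X=\{x:u_t(x)\le0,\ t\in[\bar n]\}$, $\bar Y=\{y:v_s(y)\le0,\ s\in[\bar m]\}$ with Lipschitz continuous convex functions $u_t:\mathbb{R}^n\to\mathbb{R}$, $v_s:\mathbb{R}^m\to\mathbb{R}$. Put $\tilde X_i=[\underline{\mathbf u}_i,\overline{\mathbf u}_i]$, $\tilde Y_j=[\underline{\mathbf v}_j,\overline{\mathbf v}_j]$, $\mathcal{T}_0(x)=\{t:u_t(x)=0\}$, $\mathcal{S}_0(y)=\{s:v_s(y)=0\}$. $L_{c,1}>0$ is a constant with $\|\partial_x c(x,y)\|_\infty\le L_{c,1}$ and $\|\partial_y c(x,y)\|_\infty\le L_{c,1}$ for all $(x,y)\in X\times Y$. The objective is $$f(x,y)=c(x,y)+\lambda_1\sum_{i=1}^n\big((g_i(x_i)_+)^0+(g_{n+i}(x_i)_+)^0\big)-\lambda_2\sum_{j=1}^m\big((h_j(y_j)_+)^0+(h_{m+j}(y_j)_+)^0\big).$$ Structural condition (A) with constants $\tau,\sigma>0$: (i) for any $x\in X$, $i\in[n]$ and $(\hat i,\check i)\in\{(i,n+i),(n+i,i)\}$,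 if $g_{\hat i}(x_i)\in(0,\tau)$ then $x_i\in\mathrm{int}(\tilde X_i)$, $g_{\check i}(x_i)\notin[0,\tau]$, $|g_{\hat i}'(x_i)|\ge\sigma$, and $\xi_i\,g_{\hat i}'(x_i)\ge0$ for all $\xi\in\partial u_t(x)$, $t\in\mathcal{T}_0(x)$; (ii) for any $y\in Y$, $j\in[m]$ and $(\hat j,\check j)\in\{(j,m+j),(m+j,j)\}$, if $h_{\hat j}(y_j)\in(0,\tau)$ then $y_j\in\mathrm{int}(\tilde Y_j)$, $h_{\check j}(y_j)\notin[0,\tau]$, $|h_{\hat j}'(y_j)|\ge\sigma$, and $\eta_j\,h_{\hat j}'(y_j)\ge0$ for all $\eta\in\partial v_s(y)$, $s\in\mathcal{S}_0(y)$. Relaxation. The density is $\rho(s)=1$ for $0\le s\le1$ and $\rho(s)=0$ otherwise, so that $r(t,\mu)=\int_{-\infty}^{t/\mu}\rho(s)\,ds=t_+/\mu-(t-\mu)_+/\mu$. For $\mu>0$, $$f^R(x,y,\mu)=c(x,y)+\lambda_1\sum_{i=1}^n\big(r(g_i(x_i),\mu)+r(g_{n+i}(x_i),\mu)\big)-\lambda_2\sum_{j=1}^m\big(r(h_j(y_j),\mu)+r(h_{m+j}(y_j),\mu)\big).$$ Weak d-stationarity. Let $\varpi_1(t)=t$, $\varpi_2(t)=0$, $\varpi(t)=\max\{\varpi_1(t),\varpi_2(t)\}$ and $\mathcal{D}(t)=\{d\in\{1,2\}:\varpi(t)=\varpi_d(t)\}$; thus $\varpi_1'=1$, $\varpi_2'=0$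 and $\partial\varpi(t)$ is $\{1\}$, $[0,1]$, $\{0\}$ for $t>0$, $t=0$, $t<0$ respectively. $(x^*,y^* )\in X\times Y$ is a weak d-stationary point of $\min_{x\in X}\max_{y\in Y}f^R(x,y,\mu)$ if there exist $q^*_{k}\in\mathcal{D}(g_{k}(x_i^* )-\mu)$ ($k\in\{i,n+i\}$, $i\in[n]$) and $p^*_{k}\in\mathcal{D}(h_{k}(y_j^* )-\mu)$ ($k\in\{j,m+j\}$, $j\in[m]$) such that $$\frac{\lambda_1}{\mu}\sum_{i=1}^n\big(\varpi_{q_i^*}'\,g_i'(x_i^* )+\varpi_{q_{n+i}^*}'\,g_{n+i}'(x_i^* )\big)e_i\in\partial_x c(x^*,y^* )+\frac{\lambda_1}{\mu}\sum_{i=1}^n\big(\partial\varpi(g_i(x_i^* ))g_i'(x_i^* )+\partial\varpi(g_{n+i}(x_i^* ))g_{n+i}'(x_i^* )\big)e_i+\mathcal{N}_X(x^* ),$$ $$\frac{\lambda_2}{\mu}\sum_{j=1}^m\big(\varpi_{p_j^*}'\,h_j'(y_j^* )+\varpi_{p_{m+j}^*}'\,h_{m+j}'(y_j^* )\big)e_j\in-\partial_y c(x^*,y^* )+\frac{\lambda_2}{\mu}\sum_{j=1}^m\big(\partial\varpi(h_j(y_j^* ))h_j'(y_j^* )+\partial\varpi(h_{m+j}(y_j^* ))h_{m+j}'(y_j^* )\big)e_j+\mathcal{N}_Y(y^* ).$$ Strong local saddle points. $(x^*,y^* )\in X\times Y$ is a local saddle point of $\min_{x\in X}\max_{y\in Y}f(x,y)$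 if there is a $\delta>0$ such that $f(x^*,y)\le f(x^*,y^* )\le f(x,y^* )$ for all $x\in X\cap\mathbf{B}(x^*,\delta)$, $y\in Y\cap\mathbf{B}(y^*,\delta)$. For $\nu>0$ it is a $\nu$-strong local saddle point if in addition $g_i(x^*_i),g_{n+i}(x^*_i)\notin(0,\nu)$ for all $i\in[n]$ and $h_j(y^*_j),h_{m+j}(y^*_j)\notin(0,\nu)$ for all $j\in[m]$.
   Formalization: Slater's condition is added: some x has u_t(x)<0 for all t, and some y has v_s(y)<0 for all s. With only nonempty interior of X and Y the claim fails, e.g. for u_1(x)=sqrt(1+max(x,0)^2)-1 on [-1,1], where the Clarke subdifferential of u_1 at 0 is {0}. *)

theory Defs
  imports "HOL-Analysis.Analysis"
begin

text \<open>
  Index conventions: the coordinates \<open>[n]\<close> and \<open>[m]\<close> are the finite index types of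
  \<open>real ^ 'n\<close> and \<open>real ^ 'm\<close>. A family with indices in \<open>[2n]\<close> is indexed by the disjoint sum
  \<open>'n + 'n\<close>, where \<open>Inl i\<close> stands for \<open>i\<close> and \<open>Inr i\<close> for \<open>n + i\<close>. The functional constraints
  are indexed by natural numbers and only the indices \<open>{1..N}\<close> are used.
\<close>

section \<open>Nonsmooth analysis\<close>

definition clarke_dd :: "('a::euclidean_space \<Rightarrow> real) \<Rightarrow> 'a \<Rightarrow> 'a \<Rightarrow> ereal" where
  "clarke_dd \<phi> x v =
     Limsup (nhds x \<times>\<^sub>F at_right 0) (\<lambda>(z, t). ereal ((\<phi> (z + t *\<^sub>R v) - \<phi> z) / t))"

definition clarke_subdiff :: "('a::euclidean_space \<Rightarrow> real) \<Rightarrow> 'a \<Rightarrow> 'a set" where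
  "clarke_subdiff \<phi> x = {\<xi>. \<forall>v. ereal (\<xi> \<bullet> v) \<le> clarke_dd \<phi> x v}"

definition normal_cone :: "'a::real_inner set \<Rightarrow> 'a \<Rightarrow> 'a set" where
  "normal_cone \<Omega> x = {w. x \<in> \<Omega> \<and> (\<forall>z\<in>\<Omega>. w \<bullet> (z - x) \<le> 0)}"

text \<open>The supremum is taken in the extended reals, so that an unbounded set has norm \<open>\<infinity>\<close>.\<close>

definition set_infnorm :: "'a::euclidean_space set \<Rightarrow> ereal" where
  "set_infnorm S = (SUP s\<in>S. ereal (infnorm s))"

section \<open>Problem data\<close>

definition feasible_set ::
  "real ^ 'n \<Rightarrow> real ^ 'n \<Rightarrow> nat \<Rightarrow> (nat \<Rightarrow> real ^ 'n \<Rightarrow> real) \<Rightarrow> (real ^ 'n) set" where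
  "feasible_set lo hi N u = {lo..hi} \<inter> {x. \<forall>t\<in>{1..N}. u t x \<le> 0}"

text \<open>
  Besides a nonempty interior of \<open>feasible_set\<close>, the theorem needs that the functional
  constraints are jointly strict at some point (Slater). A nonempty interior alone does not make
  the normal cone generated by the box and the Clarke subdifferentials of the active \<open>u t\<close>, and
  \<open>structural_condition\<close> sees the constraints through these subdifferentials only. For instance,
  with \<open>n = 1\<close>, \<open>u 1 x = sqrt (1 + (max x 0)\<^sup>2) - 1\<close> on the box \<open>{-1..1}\<close> has feasible set
  \<open>{-1..0}\<close> but \<open>\<partial>(u 1)(0) = {0}\<close>. For \<open>c = 0\<close>, \<open>g (Inl i) x = 1/10 - x\<close>, \<open>g (Inr i) = -1\<close>, \<open>h = -1\<close>,
  \<open>\<lambda>\<^sub>1 = \<lambda>\<^sub>2 = \<sigma> = L = 1\<close>, \<open>\<tau> = 1/2\<close>, \<open>\<mu> = 3/10\<close> the point \<open>x = 0\<close> is then weakly d-stationary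
  although \<open>g (Inl i) 0 = 1/10\<close> lies in \<open>(0, \<mu>)\<close>.
\<close>

text \<open>\<open>pos_part_pow0 t\<close> is \<open>(t\<^sub>+)\<^sup>0\<close> with the convention that it vanishes for \<open>t \<le> 0\<close>
  (whereas \<open>0 ^ 0 = 1\<close> in the library).\<close>

definition pos_part_pow0 :: "real \<Rightarrow> real" where
  "pos_part_pow0 t = (if t > 0 then 1 else 0)"

definition objective ::
  "(real ^ 'n \<Rightarrow> real ^ 'm \<Rightarrow> real) \<Rightarrow> real \<Rightarrow> real \<Rightarrow> ('n + 'n \<Rightarrow> real \<Rightarrow> real) \<Rightarrow>
   ('m + 'm \<Rightarrow> real \<Rightarrow> real) \<Rightarrow> real ^ 'n \<Rightarrow> real ^ 'm \<Rightarrow> real" where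
  "objective c lam1 lam2 g h x y =
     c x y
     + lam1 * (\<Sum>i\<in>UNIV. pos_part_pow0 (g (Inl i) (x $ i)) + pos_part_pow0 (g (Inr i) (x $ i)))
     - lam2 * (\<Sum>j\<in>UNIV. pos_part_pow0 (h (Inl j) (y $ j)) + pos_part_pow0 (h (Inr j) (y $ j)))"

text \<open>One half of the structural condition; it is used for \<open>X\<close>, \<open>g\<close>, \<open>u\<close> and for \<open>Y\<close>, \<open>h\<close>, \<open>v\<close>.\<close>

definition structural_condition ::
  "real ^ 'n \<Rightarrow> real ^ 'n \<Rightarrow> nat \<Rightarrow> (nat \<Rightarrow> real ^ 'n \<Rightarrow> real) \<Rightarrow> ('n + 'n \<Rightarrow> real \<Rightarrow> real) \<Rightarrow>
   real \<Rightarrow> real \<Rightarrow> bool" where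
  "structural_condition lo hi N u g \<tau> \<sigma> \<longleftrightarrow>
     (\<forall>x\<in>feasible_set lo hi N u. \<forall>i. \<forall>(k, k')\<in>{(Inl i, Inr i), (Inr i, Inl i)}.
        g k (x $ i) \<in> {0<..<\<tau>} \<longrightarrow>
          x $ i \<in> interior {lo $ i..hi $ i} \<and>
          g k' (x $ i) \<notin> {0..\<tau>} \<and>
          \<bar>deriv (g k) (x $ i)\<bar> \<ge> \<sigma> \<and>
          (\<forall>t\<in>{1..N}. u t x = 0 \<longrightarrow>
             (\<forall>\<xi>\<in>clarke_subdiff (u t) x. \<xi> $ i * deriv (g k) (x $ i) \<ge> 0)))"

section \<open>Relaxation by the uniform density on the unit interval\<close>

definition uniform_density :: "real \<Rightarrow> real" where
  "uniform_density s = (if 0 \<le> s \<and> s \<le> 1 then 1 else 0)"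

definition relax :: "real \<Rightarrow> real \<Rightarrow> real" where
  "relax t \<mu> = integral {..t / \<mu>} uniform_density"

definition relaxed_objective ::
  "(real ^ 'n \<Rightarrow> real ^ 'm \<Rightarrow> real) \<Rightarrow> real \<Rightarrow> real \<Rightarrow> ('n + 'n \<Rightarrow> real \<Rightarrow> real) \<Rightarrow>
   ('m + 'm \<Rightarrow> real \<Rightarrow> real) \<Rightarrow> real ^ 'n \<Rightarrow> real ^ 'm \<Rightarrow> real \<Rightarrow> real" where
  "relaxed_objective c lam1 lam2 g h x y \<mu> =
     c x y
     + lam1 * (\<Sum>i\<in>UNIV. relax (g (Inl i) (x $ i)) \<mu> + relax (g (Inr i) (x $ i)) \<mu>)
     - lam2 * (\<Sum>j\<in>UNIV. relax (h (Inl j) (y $ j)) \<mu> + relax (h (Inr j) (y $ j)) \<mu>)"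

definition ramp_piece :: "nat \<Rightarrow> real \<Rightarrow> real" where
  "ramp_piece d t = (if d = 1 then t else 0)"

definition ramp :: "real \<Rightarrow> real" where
  "ramp t = max (ramp_piece 1 t) (ramp_piece 2 t)"

definition active_pieces :: "real \<Rightarrow> nat set" where
  "active_pieces t = {d \<in> {1, 2}. ramp t = ramp_piece d t}"

text \<open>The splitting of \<open>relax\<close> into a difference of convex ramps underlies the stationarity
  notion below: the subtracted ramp is replaced by one active piece, the other one by its
  Clarke subdifferential.\<close>

lemma relax_eq_ramp:
  assumes "\<mu> > 0"
  shows "relax t \<mu> = ramp t / \<mu> - ramp (t - \<mu>) / \<mu>"
proof -
  define a where "a = t / \<mu>"
  have "(uniform_density has_integral (max 0 (min a 1))) {..a}"
  proof -
    have "((\<lambda>_. 1::real) has_integral (max 0 (min a 1))) {0..min a 1}"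
      using has_integral_const_real[of "1::real" 0 "min a 1"] by (auto simp: max_def)
    then have "((\<lambda>s. if s \<in> {0..min a 1} then 1 else 0) has_integral (max 0 (min a 1))) {..a}"
      by (subst has_integral_restrict) auto
    then show ?thesis
      by (rule has_integral_eq[rotated]) (auto simp: uniform_density_def)
  qed
  then have "relax t \<mu> = max 0 (min a 1)"
    unfolding relax_def a_def by (rule integral_unique)
  also have "\<dots> = ramp t / \<mu> - ramp (t - \<mu>) / \<mu>"
    using assms by (auto simp: a_def ramp_def ramp_piece_def max_def min_def field_simps)
  finally show ?thesis .
qed

text \<open>\<open>wd_inclusion S l \<mu> g \<Omega> z q\<close> is the inclusion
  \<open>(l/\<mu>) \<Sum>\<^sub>i (\<dots>) e\<^sub>i \<in> S + (l/\<mu>) \<Sum>\<^sub>i (\<dots>) e\<^sub>i + N\<^sub>\<Omega>(z)\<close> with Minkowski sums of sets; \<open>a k\<close> ranges over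
  \<open>\<partial>ramp (g\<^sub>k(z\<^sub>i))\<close>. The set \<open>S\<close> is \<open>\<partial>\<^sub>x c\<close> for the minimizing and \<open>-\<partial>\<^sub>y c\<close> for the maximizing block.\<close>

definition wd_inclusion ::
  "(real ^ 'n) set \<Rightarrow> real \<Rightarrow> real \<Rightarrow> ('n + 'n \<Rightarrow> real \<Rightarrow> real) \<Rightarrow> (real ^ 'n) set \<Rightarrow> real ^ 'n \<Rightarrow>
   ('n + 'n \<Rightarrow> nat) \<Rightarrow> bool" where
  "wd_inclusion S l \<mu> g \<Omega> z q \<longleftrightarrow>
     (l / \<mu>) *\<^sub>R (\<Sum>i\<in>UNIV.
        (deriv (ramp_piece (q (Inl i))) (g (Inl i) (z $ i) - \<mu>) * deriv (g (Inl i)) (z $ i)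
         + deriv (ramp_piece (q (Inr i))) (g (Inr i) (z $ i) - \<mu>) * deriv (g (Inr i)) (z $ i))
        *\<^sub>R axis i 1)
     \<in> S
       + {(l / \<mu>) *\<^sub>R (\<Sum>i\<in>UNIV.
            (a (Inl i) * deriv (g (Inl i)) (z $ i) + a (Inr i) * deriv (g (Inr i)) (z $ i))
            *\<^sub>R axis i 1) | a.
          \<forall>i. a (Inl i) \<in> clarke_subdiff ramp (g (Inl i) (z $ i)) \<and>
              a (Inr i) \<in> clarke_subdiff ramp (g (Inr i) (z $ i))}
       + normal_cone \<Omega> z"

text \<open>Weak d-stationary points of the min-max problem for \<open>relaxed_objective\<close>.\<close>

definition weak_d_stationary ::
  "(real ^ 'n \<Rightarrow> real ^ 'm \<Rightarrow> real) \<Rightarrow> real \<Rightarrow> real \<Rightarrow> ('n + 'n \<Rightarrow> real \<Rightarrow> real) \<Rightarrow>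
   ('m + 'm \<Rightarrow> real \<Rightarrow> real) \<Rightarrow> (real ^ 'n) set \<Rightarrow> (real ^ 'm) set \<Rightarrow> real \<Rightarrow>
   real ^ 'n \<Rightarrow> real ^ 'm \<Rightarrow> bool" where
  "weak_d_stationary c lam1 lam2 g h X Y \<mu> x y \<longleftrightarrow>
     x \<in> X \<and> y \<in> Y \<and>
     (\<exists>q p.
        (\<forall>i. q (Inl i) \<in> active_pieces (g (Inl i) (x $ i) - \<mu>) \<and>
             q (Inr i) \<in> active_pieces (g (Inr i) (x $ i) - \<mu>)) \<and>
        (\<forall>j. p (Inl j) \<in> active_pieces (h (Inl j) (y $ j) - \<mu>) \<and>
             p (Inr j) \<in> active_pieces (h (Inr j) (y $ j) - \<mu>)) \<and>
        wd_inclusion (clarke_subdiff (\<lambda>x'. c x' y) x) lam1 \<mu> g X x q \<and>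
        wd_inclusion (uminus ` clarke_subdiff (\<lambda>y'. c x y') y) lam2 \<mu> h Y y p)"

section \<open>Strong local saddle points\<close>

definition local_saddle_point ::
  "('a::metric_space \<Rightarrow> 'b::metric_space \<Rightarrow> real) \<Rightarrow> 'a set \<Rightarrow> 'b set \<Rightarrow> 'a \<Rightarrow> 'b \<Rightarrow> bool" where
  "local_saddle_point f X Y x y \<longleftrightarrow>
     x \<in> X \<and> y \<in> Y \<and>
     (\<exists>\<delta>>0. \<forall>x'\<in>X \<inter> cball x \<delta>. \<forall>y'\<in>Y \<inter> cball y \<delta>. f x y' \<le> f x y \<and> f x y \<le> f x' y)"

definition strong_local_saddle_point ::
  "real \<Rightarrow> (real ^ 'n \<Rightarrow> real ^ 'm \<Rightarrow> real) \<Rightarrow> real \<Rightarrow> real \<Rightarrow> ('n + 'n \<Rightarrow> real \<Rightarrow> real) \<Rightarrow>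
   ('m + 'm \<Rightarrow> real \<Rightarrow> real) \<Rightarrow> (real ^ 'n) set \<Rightarrow> (real ^ 'm) set \<Rightarrow> real ^ 'n \<Rightarrow> real ^ 'm \<Rightarrow> bool"
  where
  "strong_local_saddle_point \<nu> c lam1 lam2 g h X Y x y \<longleftrightarrow>
     local_saddle_point (objective c lam1 lam2 g h) X Y x y \<and>
     (\<forall>i. g (Inl i) (x $ i) \<notin> {0<..<\<nu>} \<and> g (Inr i) (x $ i) \<notin> {0<..<\<nu>}) \<and>
     (\<forall>j. h (Inl j) (y $ j) \<notin> {0<..<\<nu>} \<and> h (Inr j) (y $ j) \<notin> {0<..<\<nu>})"

end

theory Submission
  imports Defs
begin

text \<open>
  The two inclusions of weak d-stationarity concern one block of variables each, and the second
  one is the first one for minimizing \<open>- c xs\<close> over \<open>Y\<close>. So everything rests on a statement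
  about one block, \<open>stationary_block_optimal\<close>. For convex functions the Clarke subdifferential
  is the convex one, which turns every inclusion into global affine minorants. Moving the ramp terms
  to one side, the inclusion says, in coordinate \<open>i\<close> with its two functions \<open>g\<^sub>k\<close> and \<open>g\<^sub>j\<close>,
  \<open>(l/\<mu>) (b\<^sub>k g\<^sub>k' + b\<^sub>j g\<^sub>j') = \<xi>\<^sub>i + w\<^sub>i\<close>. Here the derivatives are taken at the given point \<open>z\<close>,
  \<open>\<xi>\<close> is a subgradient of the convex part of the objective, \<open>w\<close> is a normal vector of the
  feasible set, and the weights \<open>b\<^sub>k, b\<^sub>j \<in> [-1,0]\<close> vanish unless the value of the respective
  function lies in \<open>[0,\<mu>]\<close> (\<open>ramp_weight\<close>).

  Suppose that \<open>0 < g\<^sub>k \<le> \<mu>\<close> and \<open>b\<^sub>k = -1\<close>. The structural condition makes \<open>b\<^sub>j\<close> vanish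
  and gives \<open>\<bar>g\<^sub>k'\<bar> \<ge> \<sigma>\<close>. Since \<open>\<mu> < l \<sigma> / L\<close>, the number \<open>\<xi>\<^sub>i\<close> is too small to balance
  \<open>(l/\<mu>) g\<^sub>k'\<close>, so \<open>w\<^sub>i\<close> would have the sign opposite to \<open>g\<^sub>k'\<close>. But the structural condition
  also says that moving coordinate \<open>i\<close> against \<open>g\<^sub>k'\<close> does not leave the feasible set to first
  order, which forbids that sign (\<open>normal_cone_component_sign\<close>). Values in \<open>(0,\<mu>)\<close> force
  \<open>b\<^sub>k = -1\<close> and are therefore impossible, and at the value \<open>\<mu>\<close> only the weight \<open>0\<close> survives.

  Hence \<open>b\<^sub>k \<noteq> 0\<close> only where \<open>g\<^sub>k = 0\<close>. There the linear term \<open>(b\<^sub>k/\<mu>) g\<^sub>k' (x\<^sub>i - z\<^sub>i)\<close> is nonnegative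
  as long as \<open>g\<^sub>k\<close> stays nonpositive, by convexity of \<open>g\<^sub>k\<close>, and as soon as \<open>g\<^sub>k\<close> becomes positive the
  counting term jumps by 1, which absorbs the linear term near the point (\<open>pos_part_pow0_jump\<close>).
  Adding these estimates to the affine minorant of the convex part gives local optimality.
\<close>

section \<open>Convex subgradients and Clarke subgradients\<close>

definition subgradients :: "('a::euclidean_space \<Rightarrow> real) \<Rightarrow> 'a \<Rightarrow> 'a set" where
  "subgradients \<phi> x = {\<xi>. \<forall>y. \<phi> x + \<xi> \<bullet> (y - x) \<le> \<phi> y}"

text \<open>A continuous bound on the difference quotients, uniform in the step, passes to the upper
  limit. Convex and concave functions provide such bounds by monotonicity of their slopes.\<close>

lemma clarke_dd_le_limit:
  fixes \<phi> \<theta> :: "'a::euclidean_space \<Rightarrow> real"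
  assumes quot: "\<And>z t. 0 < t \<Longrightarrow> t \<le> 1 \<Longrightarrow> (\<phi> (z + t *\<^sub>R v) - \<phi> z) / t \<le> \<theta> z"
    and cont: "isCont \<theta> x"
  shows "clarke_dd \<phi> x v \<le> ereal (\<theta> x)"
proof -
  let ?F = "nhds x \<times>\<^sub>F at_right (0::real)"
  have nontriv: "?F \<noteq> bot"
    by (simp add: prod_filter_eq_bot)
  have "eventually (\<lambda>t::real. 0 < t \<and> t \<le> 1) (at_right 0)"
    using eventually_at_right_real[OF zero_less_one] by eventually_elim auto
  then have "eventually (\<lambda>p. 0 < snd p \<and> snd p \<le> 1) ?F"
    using filterlim_snd filterlim_iff by fastforce
  then have le: "eventually (\<lambda>p. (case p of (z, t) \<Rightarrow> ereal ((\<phi> (z + t *\<^sub>R v) - \<phi> z) / t))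
      \<le> ereal (\<theta> (fst p))) ?F"
    by eventually_elim (auto intro: quot)
  have "(\<theta> \<longlongrightarrow> \<theta> x) (nhds x)"
    using cont by (metis isCont_def tendsto_at_iff_tendsto_nhds)
  then have "((\<lambda>p. ereal (\<theta> (fst p))) \<longlongrightarrow> ereal (\<theta> x)) ?F"
    by (intro tendsto_intros) (rule filterlim_compose[OF _ filterlim_fst])
  then have "Limsup ?F (\<lambda>p. ereal (\<theta> (fst p))) = ereal (\<theta> x)"
    using lim_imp_Limsup[OF nontriv] by blast
  then show ?thesis
    unfolding clarke_dd_def using Limsup_mono[OF le] by simp
qed

text \<open>Slopes of a convex function increase, so the quotient over a short step is at most the
  quotient over the unit step, which is continuous in the base point. The converse holds because the
  upper limit sees the quotients with the base point \<open>x\<close> itself.\<close>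

lemma clarke_subdiff_convex:
  fixes \<phi> :: "'a::euclidean_space \<Rightarrow> real"
  assumes cvx: "convex_on UNIV \<phi>"
  shows "clarke_subdiff \<phi> x = subgradients \<phi> x"
proof (intro set_eqI iffI)
  fix \<xi> assume "\<xi> \<in> clarke_subdiff \<phi> x"
  then have \<xi>: "ereal (\<xi> \<bullet> v) \<le> clarke_dd \<phi> x v" for v
    by (simp add: clarke_subdiff_def)
  have cont: "isCont \<phi> z" for z
    using convex_on_continuous[OF open_UNIV cvx] by (simp add: continuous_on_eq_continuous_at)
  have "\<phi> x + \<xi> \<bullet> (y - x) \<le> \<phi> y" for y
  proof -
    define v where "v = y - x"
    have quot: "(\<phi> (z + t *\<^sub>R v) - \<phi> z) / t \<le> \<phi> (z + v) - \<phi> z" if "0 < t" "t \<le> 1" for z t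
    proof -
      have "z + t *\<^sub>R v = (1 - t) *\<^sub>R z + t *\<^sub>R (z + v)"
        by (simp add: algebra_simps)
      then have "\<phi> (z + t *\<^sub>R v) \<le> (1 - t) * \<phi> z + t * \<phi> (z + v)"
        using convex_onD[OF cvx, of t z "z + v"] that by simp
      then show ?thesis
        using that by (simp add: field_simps)
    qed
    have "isCont (\<lambda>z. \<phi> (z + v) - \<phi> z) x"
      by (intro continuous_intros isCont_o2[OF _ cont] cont)
    from clarke_dd_le_limit[of \<phi> v, OF quot this] \<xi>[of v]
    have "ereal (\<xi> \<bullet> v) \<le> ereal (\<phi> (x + v) - \<phi> x)"
      using order_trans by blast
    then show ?thesis
      by (simp add: v_def)
  qed
  then show "\<xi> \<in> subgradients \<phi> x"
    by (simp add: subgradients_def)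
next
  fix \<xi> assume "\<xi> \<in> subgradients \<phi> x"
  then have \<xi>: "\<phi> x + \<xi> \<bullet> (y - x) \<le> \<phi> y" for y
    by (simp add: subgradients_def)
  have "ereal (\<xi> \<bullet> v) \<le> clarke_dd \<phi> x v" for v
    unfolding clarke_dd_def Limsup_def
  proof (intro INF_greatest)
    fix P assume "P \<in> {P. eventually P (nhds x \<times>\<^sub>F at_right (0::real))}"
    then obtain Pf Pg where ev: "eventually Pf (nhds x)" "eventually Pg (at_right (0::real))"
      and P: "\<And>a b. Pf a \<Longrightarrow> Pg b \<Longrightarrow> P (a, b)"
      by (auto simp: eventually_prod_filter)
    have "eventually (\<lambda>t. Pg t \<and> t > 0) (at_right (0::real))"
      using ev(2) eventually_at_right_less by (rule eventually_conj)
    then obtain t where t: "Pg t" "t > 0"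
      using eventually_happens'[OF trivial_limit_at_right_real] by blast
    have "P (x, t)"
      using P t ev(1) by (simp add: eventually_nhds_x_imp_x)
    moreover have "\<xi> \<bullet> v \<le> (\<phi> (x + t *\<^sub>R v) - \<phi> x) / t"
      using \<xi>[of "x + t *\<^sub>R v"] t by (simp add: field_simps)
    ultimately show "ereal (\<xi> \<bullet> v)
        \<le> (SUP p\<in>Collect P. case p of (z, t) \<Rightarrow> ereal ((\<phi> (z + t *\<^sub>R v) - \<phi> z) / t))"
      by (intro SUP_upper2[of "(x, t)"]) auto
  qed
  then show "\<xi> \<in> clarke_subdiff \<phi> x"
    by (simp add: clarke_subdiff_def)
qed

text \<open>For a concave function the slope over a short forward step is at most the slope over the
  unit step backwards. This is what transfers the inclusion in \<open>y\<close> to the convex function \<open>- c xs\<close>.\<close>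

lemma clarke_subdiff_concave:
  fixes \<psi> :: "'a::euclidean_space \<Rightarrow> real"
  assumes ccv: "concave_on UNIV \<psi>" and \<xi>: "\<xi> \<in> clarke_subdiff \<psi> x"
  shows "- \<xi> \<in> subgradients (\<lambda>y. - \<psi> y) x"
proof -
  have cvx: "convex_on UNIV (\<lambda>y. - \<psi> y)"
    using ccv by (simp add: concave_on_def)
  have cont: "isCont \<psi> z" for z
  proof -
    have "isCont (\<lambda>y. - \<psi> y) z"
      using convex_on_continuous[OF open_UNIV cvx] by (simp add: continuous_on_eq_continuous_at)
    from isCont_minus[OF this] show ?thesis by simp
  qed
  have "\<psi> y \<le> \<psi> x + \<xi> \<bullet> (y - x)" for y
  proof -
    define v where "v = x - y"
    have quot: "(\<psi> (z + t *\<^sub>R v) - \<psi> z) / t \<le> \<psi> z - \<psi> (z - v)" if t: "0 < t" "t \<le> 1" for z t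
    proof -
      \<comment> \<open>\<open>z\<close> divides the segment from \<open>z + t v\<close> to \<open>z - v\<close> in the ratio \<open>t : 1\<close>.\<close>
      have w: "1 - t / (1 + t) = 1 / (1 + t)" using t by (simp add: field_simps)
      have "(1 / (1 + t)) *\<^sub>R ((z + t *\<^sub>R v) + t *\<^sub>R (z - v)) = (1 / (1 + t)) *\<^sub>R ((1 + t) *\<^sub>R z)"
        by (rule arg_cong) (simp add: algebra_simps)
      then have "z = (1 / (1 + t)) *\<^sub>R (z + t *\<^sub>R v) + (t / (1 + t)) *\<^sub>R (z - v)"
        using t by (simp add: scaleR_add_right)
      then have "- \<psi> z \<le> 1 / (1 + t) * - \<psi> (z + t *\<^sub>R v) + t / (1 + t) * - \<psi> (z - v)"
        using convex_onD[OF cvx, of "t / (1 + t)" "z + t *\<^sub>R v" "z - v"] t by (simp add: w)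
      also have "\<dots> = (- \<psi> (z + t *\<^sub>R v) - t * \<psi> (z - v)) / (1 + t)"
        by (simp add: diff_divide_distrib)
      finally have "- \<psi> z * (1 + t) \<le> - \<psi> (z + t *\<^sub>R v) - t * \<psi> (z - v)"
        using t by (simp add: pos_le_divide_eq)
      then have "\<psi> (z + t *\<^sub>R v) - \<psi> z \<le> (\<psi> z - \<psi> (z - v)) * t"
        by (simp add: algebra_simps)
      then show ?thesis
        using t by (simp only: pos_divide_le_eq)
    qed
    have "isCont (\<lambda>z. \<psi> z - \<psi> (z - v)) x"
      by (intro continuous_intros isCont_o2[OF _ cont] cont)
    from clarke_dd_le_limit[of \<psi> v, OF quot this] \<xi>
    have "ereal (\<xi> \<bullet> v) \<le> ereal (\<psi> x - \<psi> (x - v))"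
      unfolding clarke_subdiff_def using order_trans by blast
    then show ?thesis
      by (simp add: v_def inner_diff_right)
  qed
  then have "- \<psi> x + - \<xi> \<bullet> (y - x) \<le> - \<psi> y" for y
    unfolding inner_minus_left by (metis add.inverse_distrib_swap add.commute neg_le_iff_le)
  then show ?thesis
    unfolding subgradients_def by blast
qed

text \<open>If \<open>\<phi>\<close> does not fall below \<open>\<phi> z\<close> along a ray, then the horizontal ray at height \<open>\<phi> z\<close> misses
  the strict epigraph. A hyperplane separating the two is the graph of an affine minorant whose slope
  is the wanted subgradient. Contrapositively, a direction on which all subgradients are
  negative is a descent direction; the normal cone is treated in this form, without
  a formula for its generators.\<close>

lemma subgradient_of_nondescent_direction:
  fixes \<phi> :: "'a::euclidean_space \<Rightarrow> real"
  assumes cvx: "convex_on UNIV \<phi>"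
    and nondescent: "\<And>s. s \<ge> 0 \<Longrightarrow> \<phi> z \<le> \<phi> (z + s *\<^sub>R v)"
  obtains \<zeta> where "\<zeta> \<in> subgradients \<phi> z" "\<zeta> \<bullet> v \<ge> 0"
proof -
  let ?R = "(\<lambda>s. (z + s *\<^sub>R v, \<phi> z)) ` {0..}"
  let ?E = "{p. \<phi> (fst p) < snd p}"
  have "convex ?R"
  proof (rule convexI)
    fix p q :: "'a \<times> real" and r r' :: real
    assume "p \<in> ?R" "q \<in> ?R" and r: "0 \<le> r" "0 \<le> r'" "r + r' = 1"
    then obtain s s' where s: "s \<ge> 0" "s' \<ge> 0" "p = (z + s *\<^sub>R v, \<phi> z)" "q = (z + s' *\<^sub>R v, \<phi> z)"
      by auto
    have "r *\<^sub>R z + r' *\<^sub>R z = z" "r * \<phi> z + r' * \<phi> z = \<phi> z"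
      using r(3) by (simp_all flip: scaleR_add_left distrib_right)
    then have "r *\<^sub>R p + r' *\<^sub>R q = (z + (r * s + r' * s') *\<^sub>R v, \<phi> z)"
      unfolding s by (simp add: algebra_simps)
    then show "r *\<^sub>R p + r' *\<^sub>R q \<in> ?R"
      using r s by (intro image_eqI[of _ _ "r * s + r' * s'"]) auto
  qed
  moreover have "convex ?E"
  proof (rule convexI)
    fix p q :: "'a \<times> real" and r r' :: real
    assume p: "p \<in> ?E" and q: "q \<in> ?E" and r: "0 \<le> r" "0 \<le> r'" "r + r' = 1"
    have "\<phi> (r *\<^sub>R fst p + r' *\<^sub>R fst q) \<le> r * \<phi> (fst p) + r' * \<phi> (fst q)"
      using cvx r unfolding convex_on_def by auto
    also have "\<dots> < r * snd p + r' * snd q"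
    proof (cases "r = 0")
      case True then show ?thesis using q r by simp
    next
      case False
      then show ?thesis
        using p q r by (intro add_less_le_mono mult_strict_left_mono mult_left_mono) auto
    qed
    finally show "r *\<^sub>R p + r' *\<^sub>R q \<in> ?E" by simp
  qed
  moreover have "?R \<noteq> {}" by auto
  moreover have "(z, \<phi> z + 1) \<in> ?E" by simp
  then have "?E \<noteq> {}" by blast
  moreover have "?R \<inter> ?E = {}" using nondescent by force
  ultimately have "\<exists>a b. a \<noteq> 0 \<and> (\<forall>x\<in>?R. a \<bullet> x \<le> b) \<and> (\<forall>x\<in>?E. a \<bullet> x \<ge> b)"
    by (intro separating_hyperplane_sets)
  then obtain pb \<beta> where pb: "pb \<noteq> 0" "\<forall>x\<in>?R. pb \<bullet> x \<le> \<beta>" "\<forall>x\<in>?E. \<beta> \<le> pb \<bullet> x"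
    by blast
  obtain p b where pb_eq: "pb = (p, b)" by (cases pb)
  have R: "p \<bullet> z + s * (p \<bullet> v) + b * \<phi> z \<le> \<beta>" if "s \<ge> 0" for s
    using pb(2) that by (auto simp: pb_eq inner_add_right)
  have E: "\<beta> \<le> p \<bullet> x + b * r" if "\<phi> x < r" for x r
    using pb(3) that by (auto simp: pb_eq)
  have "b \<ge> 0"
    using R[of 0] E[of z "\<phi> z + 1"] by (simp add: algebra_simps)
  moreover have "b \<noteq> 0"
  proof
    assume "b = 0"
    then have "p \<bullet> p \<le> 0"
      using R[of 0] E[of "z - p" "\<phi> (z - p) + 1"] by (simp add: inner_diff_right)
    then have "p = 0" using inner_gt_zero_iff[of p] by linarith
    then show False using pb(1) \<open>b = 0\<close> by (simp add: pb_eq zero_prod_def)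
  qed
  ultimately have b: "b > 0" by simp
  have E': "\<beta> \<le> p \<bullet> x + b * \<phi> x" for x
  proof (rule field_le_epsilon)
    fix e :: real assume "0 < e"
    then show "\<beta> \<le> p \<bullet> x + b * \<phi> x + e"
      using E[of x "\<phi> x + e / b"] b by (simp add: algebra_simps)
  qed
  let ?\<zeta> = "- (1 / b) *\<^sub>R p"
  have "\<phi> z + ?\<zeta> \<bullet> (y - z) \<le> \<phi> y" for y
    using R[of 0] E'[of y] b by (simp add: field_simps inner_diff_right)
  moreover have "?\<zeta> \<bullet> v \<ge> 0"
    using R[of 1] E'[of z] b by (simp add: field_simps)
  ultimately show thesis
    by (intro that[of ?\<zeta>]) (auto simp: subgradients_def)
qed

section \<open>Normal cones of the feasible set\<close>

text \<open>The point that is strict for all functional constraints may violate the box; a small step from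
  an interior point of the feasible set towards it satisfies both requirements.\<close>

lemma strictly_feasible_point:
  assumes cvx: "\<And>t. t \<in> {1..N} \<Longrightarrow> convex_on UNIV (u t)"
    and int: "interior (feasible_set lo hi N u) \<noteq> {}"
    and slater: "\<exists>x. \<forall>t\<in>{1..N}. u t x < 0"
  obtains x where "x \<in> feasible_set lo hi N u" "\<And>t. t \<in> {1..N} \<Longrightarrow> u t x < 0"
proof -
  let ?X = "feasible_set lo hi N u"
  obtain x0 where x0: "x0 \<in> interior ?X" using int by blast
  obtain x1 where x1: "\<And>t. t \<in> {1..N} \<Longrightarrow> u t x1 < 0" using slater by blast
  have "((\<lambda>r. x0 + r *\<^sub>R (x1 - x0)) \<longlongrightarrow> x0 + 0 *\<^sub>R (x1 - x0)) (at_right 0)"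
    by (intro tendsto_intros)
  then have "eventually (\<lambda>r. x0 + r *\<^sub>R (x1 - x0) \<in> interior ?X) (at_right 0)"
    using x0 by (intro topological_tendstoD[of _ x0]) auto
  then have "eventually (\<lambda>r::real. x0 + r *\<^sub>R (x1 - x0) \<in> interior ?X \<and> 0 < r \<and> r < 1) (at_right 0)"
    using eventually_at_right_real[OF zero_less_one] by eventually_elim auto
  then obtain r :: real where r: "x0 + r *\<^sub>R (x1 - x0) \<in> interior ?X" "0 < r" "r < 1"
    using eventually_happens'[OF trivial_limit_at_right_real] by blast
  show thesis
  proof
    show "x0 + r *\<^sub>R (x1 - x0) \<in> ?X"
      using r interior_subset by blast
    fix t assume t: "t \<in> {1..N}"
    have "u t x0 \<le> 0"
      using x0 interior_subset[of ?X] t by (auto simp: feasible_set_def)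
    have "x0 + r *\<^sub>R (x1 - x0) = (1 - r) *\<^sub>R x0 + r *\<^sub>R x1"
      by (simp add: algebra_simps)
    then have "u t (x0 + r *\<^sub>R (x1 - x0)) \<le> (1 - r) * u t x0 + r * u t x1"
      using convex_onD[OF cvx[OF t], of r x0 x1] r by simp
    also have "\<dots> < 0"
      using r x1[OF t] \<open>u t x0 \<le> 0\<close>
      by (intro add_nonpos_neg mult_nonneg_nonpos mult_pos_neg) auto
    finally show "u t (x0 + r *\<^sub>R (x1 - x0)) < 0" .
  qed
qed

text \<open>The direction \<open>- s e\<^sub>i\<close> does not increase any active constraint to first order. Tilting it by
  a small multiple \<open>\<epsilon>\<close> of the direction to a strictly feasible point makes it strictly
  feasible, so a normal vector has a nonpositive product with it; letting \<open>\<epsilon>\<close> tend to 0 gives the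
  sign of \<open>w $ i * s\<close>.\<close>

lemma normal_cone_component_sign:
  fixes u :: "nat \<Rightarrow> real ^ 'n \<Rightarrow> real"
  assumes cvx: "\<And>t. t \<in> {1..N} \<Longrightarrow> convex_on UNIV (u t)"
    and int: "interior (feasible_set lo hi N u) \<noteq> {}"
    and slater: "\<exists>x. \<forall>t\<in>{1..N}. u t x < 0"
    and w: "w \<in> normal_cone (feasible_set lo hi N u) z"
    and zi: "z $ i \<in> interior {lo $ i..hi $ i}"
    and sign: "\<And>t \<zeta>. t \<in> {1..N} \<Longrightarrow> u t z = 0 \<Longrightarrow> \<zeta> \<in> subgradients (u t) z \<Longrightarrow> \<zeta> $ i * s \<ge> 0"
  shows "w $ i * s \<ge> 0"
proof -
  let ?X = "feasible_set lo hi N u"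
  obtain xh where xh: "xh \<in> ?X" "\<And>t. t \<in> {1..N} \<Longrightarrow> u t xh < 0"
    using strictly_feasible_point[OF cvx int slater] by blast
  have z: "z \<in> ?X" and w': "\<And>x. x \<in> ?X \<Longrightarrow> w \<bullet> (x - z) \<le> 0"
    using w by (auto simp: normal_cone_def)
  have key: "\<epsilon> * (w \<bullet> (xh - z)) \<le> w $ i * s" if \<epsilon>: "\<epsilon> > 0" for \<epsilon>
  proof -
    define v where "v = \<epsilon> *\<^sub>R (xh - z) - s *\<^sub>R axis i 1"
    have lim: "((\<lambda>r. z + r *\<^sub>R v) \<longlongrightarrow> z) (at_right 0)"
      by (auto intro!: tendsto_eq_intros)
    have "eventually (\<lambda>r. u t (z + r *\<^sub>R v) \<le> 0) (at_right 0)" if t: "t \<in> {1..N}" for t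
    proof (cases "u t z = 0")
      case True
      have "\<exists>r\<ge>0. u t (z + r *\<^sub>R v) < u t z"
      proof (rule ccontr)
        assume "\<not> ?thesis"
        then obtain \<zeta> where \<zeta>: "\<zeta> \<in> subgradients (u t) z" "\<zeta> \<bullet> v \<ge> 0"
          using subgradient_of_nondescent_direction[OF cvx[OF t], of z v] by (metis linorder_not_less)
        have "\<zeta> \<bullet> (xh - z) < 0"
          using \<zeta>(1) xh(2)[OF t] True by (auto simp: subgradients_def dest: spec[of _ xh])
        then have "\<epsilon> * (\<zeta> \<bullet> (xh - z)) < 0"
          using \<epsilon> by (simp add: mult_pos_neg)
        moreover have "\<zeta> \<bullet> v = \<epsilon> * (\<zeta> \<bullet> (xh - z)) - \<zeta> $ i * s"
          by (simp add: v_def inner_diff_right inner_axis)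
        ultimately show False
          using \<zeta>(2) sign[OF t True \<zeta>(1)] by linarith
      qed
      then obtain r0 where r0: "r0 \<ge> 0" "u t (z + r0 *\<^sub>R v) < 0"
        using True by auto
      then have "r0 > 0"
        using True by (cases "r0 = 0") auto
      have "eventually (\<lambda>r. r \<in> {0<..<r0}) (at_right 0)"
        using \<open>r0 > 0\<close> by (rule eventually_at_right_real)
      then show ?thesis
      proof eventually_elim
        case (elim r)
        have "z + r *\<^sub>R v = (1 - r / r0) *\<^sub>R z + (r / r0) *\<^sub>R (z + r0 *\<^sub>R v)"
          using \<open>r0 > 0\<close> by (simp add: algebra_simps)
        then have "u t (z + r *\<^sub>R v) \<le> (1 - r / r0) * u t z + r / r0 * u t (z + r0 *\<^sub>R v)"
          using convex_onD[OF cvx[OF t], of "r / r0" z "z + r0 *\<^sub>R v"] elim by simp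
        also have "\<dots> \<le> 0"
          using True r0 elim by (simp add: divide_nonneg_nonneg mult_nonneg_nonpos divide_nonpos_nonneg)
        finally show ?case .
      qed
    next
      case False
      then have neg: "u t z < 0"
        using z t by (force simp: feasible_set_def)
      have "isCont (u t) z"
        using convex_on_continuous[OF open_UNIV cvx[OF t]]
        by (simp add: continuous_on_eq_continuous_at)
      from isCont_tendsto_compose[OF this lim] neg
      have "eventually (\<lambda>r. u t (z + r *\<^sub>R v) < 0) (at_right 0)"
        by (rule order_tendstoD)
      then show ?thesis by eventually_elim simp
    qed
    then have "eventually (\<lambda>r. \<forall>t\<in>{1..N}. u t (z + r *\<^sub>R v) \<le> 0) (at_right 0)"
      by (intro eventually_ball_finite) auto
    moreover have "eventually (\<lambda>r. (z + r *\<^sub>R v) $ i \<in> interior {lo $ i..hi $ i}) (at_right 0)"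
      using topological_tendstoD[OF tendsto_vec_nth[OF lim] open_interior zi] .
    moreover have "eventually (\<lambda>r::real. r \<in> {0<..<1 / \<epsilon>}) (at_right 0)"
      using \<epsilon> by (intro eventually_at_right_real) simp
    ultimately have "eventually (\<lambda>r. 0 < r \<and> z + r *\<^sub>R v \<in> ?X) (at_right 0)"
    proof eventually_elim
      case (elim r)
      have "lo $ j \<le> (z + r *\<^sub>R v) $ j \<and> (z + r *\<^sub>R v) $ j \<le> hi $ j" for j
      \<comment> \<open>Coordinate \<open>i\<close> starts in the interior of its interval; every other one moves towards
        the feasible point \<open>xh\<close>, because \<open>s\<close> enters \<open>v\<close> in coordinate \<open>i\<close> only.\<close>
      proof (cases "j = i")
        case True
        then show ?thesis using elim(2) interior_subset[of "{lo $ i..hi $ i}"] by auto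
      next
        case False
        define q where "q = r * \<epsilon>"
        have q: "0 \<le> q" "q \<le> 1" using elim(3) \<epsilon> by (auto simp: q_def field_simps)
        have eq: "(z + r *\<^sub>R v) $ j = (1 - q) * z $ j + q * xh $ j"
          using False by (simp add: v_def q_def axis_def algebra_simps)
        have b: "lo $ j \<le> z $ j" "z $ j \<le> hi $ j" "lo $ j \<le> xh $ j" "xh $ j \<le> hi $ j"
          using z xh(1) by (auto simp: feasible_set_def less_eq_vec_def)
        have "(1 - q) * z $ j + q * xh $ j \<in> {lo $ j..hi $ j}"
          using convexD_alt[of "{lo $ j..hi $ j}" "z $ j" "xh $ j" q] b q by simp
        then show ?thesis unfolding eq by simp
      qed
      then show ?case
        using elim by (simp add: feasible_set_def less_eq_vec_def)
    qed
    then obtain r where r: "0 < r" "z + r *\<^sub>R v \<in> ?X"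
      using eventually_happens'[OF trivial_limit_at_right_real] by blast
    have "w \<bullet> v \<le> 0"
      using w'[OF r(2)] r(1) by (simp add: mult_le_0_iff)
    then show ?thesis
      by (simp add: v_def inner_diff_right inner_axis mult.commute)
  qed
  have "((\<lambda>\<epsilon>. \<epsilon> * (w \<bullet> (xh - z))) \<longlongrightarrow> 0) (at_right 0)"
    by (auto intro!: tendsto_eq_intros)
  moreover have "eventually (\<lambda>\<epsilon>. \<epsilon> * (w \<bullet> (xh - z)) \<le> w $ i * s) (at_right 0)"
    using eventually_at_right_less[of "0::real"] by eventually_elim (rule key)
  ultimately show ?thesis
    by (intro tendsto_upperbound[of _ 0 "at_right 0"]) auto
qed

section \<open>The weights in the stationarity inclusion\<close>

lemma clarke_subdiff_ramp:
  assumes a: "a \<in> clarke_subdiff ramp t"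
  shows "0 \<le> a" "a \<le> 1" "t < 0 \<Longrightarrow> a = 0" "t > 0 \<Longrightarrow> a = 1"
proof -
  have ramp: "ramp = (\<lambda>t. max t 0)"
    by (auto simp: ramp_def ramp_piece_def)
  have "convex_on UNIV ramp"
  proof (rule convex_onI)
    fix r x y :: real assume r: "0 < r" "r < 1"
    have "(1 - r) * x \<le> (1 - r) * max x 0" "r * y \<le> r * max y 0"
      "0 \<le> (1 - r) * max x 0" "0 \<le> r * max y 0"
      using r by (intro mult_left_mono mult_nonneg_nonneg; simp)+
    then show "ramp ((1 - r) *\<^sub>R x + r *\<^sub>R y) \<le> (1 - r) * ramp x + r * ramp y"
      by (simp add: ramp)
  qed simp
  then have "a \<in> subgradients ramp t"
    using a clarke_subdiff_convex by blast
  then have sub: "max t 0 + a * (s - t) \<le> max s 0" for s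
    by (simp add: subgradients_def ramp)
  show a0: "0 \<le> a" using sub[of "t - 1"] by simp
  show a1: "a \<le> 1" using sub[of "t + 1"] by simp
  show "a = 0" if "t < 0"
    using sub[of 0] that a0 by (simp add: zero_le_mult_iff mult_le_0_iff)
  show "a = 1" if "t > 0"
  proof -
    have "1 * t \<le> a * t" using sub[of 0] that by simp
    then show ?thesis using that a1 mult_right_le_imp_le by fastforce
  qed
qed

text \<open>The weight \<open>b\<close> is what remains of one function after the subgradient of the first ramp is
  subtracted from the derivative of the chosen piece of the second. Below 0 and above \<open>\<mu>\<close> the
  relaxation is flat and the two cancel; strictly between, its slope is uncompensated. At
  the kink \<open>\<mu>\<close> the choice of the piece decides between the two, so \<open>b\<close> is 0 or -1 there and not an
  intermediate value.\<close>

lemma ramp_weight: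
  assumes q: "q \<in> active_pieces (t - \<mu>)" and a: "a \<in> clarke_subdiff ramp t"
    and \<mu>: "\<mu> > 0" and b: "b = deriv (ramp_piece q) (t - \<mu>) - a"
  shows "-1 \<le> b" "b \<le> 0" "b \<noteq> 0 \<Longrightarrow> t \<in> {0..\<mu>}" "0 < t \<Longrightarrow> b \<in> {0, -1}"
    "t \<in> {0<..<\<mu>} \<Longrightarrow> b = -1"
proof -
  have "ramp_piece 1 = (\<lambda>t. t)" "ramp_piece 2 = (\<lambda>t. 0)"
    by (auto simp: ramp_piece_def)
  then have deriv: "deriv (ramp_piece 1) s = 1" "deriv (ramp_piece 2) s = 0" for s
    by simp_all
  have q': "(q = 1 \<and> t \<ge> \<mu>) \<or> (q = 2 \<and> t \<le> \<mu>)"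
    using q by (auto simp: active_pieces_def ramp_def ramp_piece_def max_def split: if_splits)
  note a' = clarke_subdiff_ramp[OF a]
  show "-1 \<le> b" "b \<le> 0" "b \<noteq> 0 \<Longrightarrow> t \<in> {0..\<mu>}" "0 < t \<Longrightarrow> b \<in> {0, -1}" "t \<in> {0<..<\<mu>} \<Longrightarrow> b = -1"
    using q' a' \<mu> deriv unfolding b by (cases "t < 0"; cases "t > 0"; auto)+
qed

lemma wd_inclusion_componentwise:
  fixes z :: "real ^ 'n" and g :: "'n + 'n \<Rightarrow> real \<Rightarrow> real"
  assumes wd: "wd_inclusion S l \<mu> g \<Omega> z q" and \<mu>: "\<mu> > 0"
    and q: "\<And>i. q (Inl i) \<in> active_pieces (g (Inl i) (z $ i) - \<mu>)"
      "\<And>i. q (Inr i) \<in> active_pieces (g (Inr i) (z $ i) - \<mu>)"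
  obtains \<xi> w b where "\<xi> \<in> S" "w \<in> normal_cone \<Omega> z"
    "\<And>i. (l / \<mu>) * (b (Inl i) * deriv (g (Inl i)) (z $ i) + b (Inr i) * deriv (g (Inr i)) (z $ i))
       = \<xi> $ i + w $ i"
    "\<And>i k. k \<in> {Inl i, Inr i} \<Longrightarrow> -1 \<le> b k \<and> b k \<le> 0 \<and> (b k \<noteq> 0 \<longrightarrow> g k (z $ i) \<in> {0..\<mu>}) \<and>
       (0 < g k (z $ i) \<longrightarrow> b k \<in> {0, -1}) \<and> (g k (z $ i) \<in> {0<..<\<mu>} \<longrightarrow> b k = -1)"
proof -
  \<comment> \<open>The derivatives of the selected pieces; the \<open>case\<close> recovers the coordinate belonging to \<open>k\<close>.\<close>
  define Q where "Q k = deriv (ramp_piece (q k)) (g k (z $ (case k of Inl i \<Rightarrow> i | Inr i \<Rightarrow> i)) - \<mu>)"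
    for k
  obtain \<xi> a w where \<xi>: "\<xi> \<in> S" and w: "w \<in> normal_cone \<Omega> z"
    and a: "\<And>i. a (Inl i) \<in> clarke_subdiff ramp (g (Inl i) (z $ i))"
      "\<And>i. a (Inr i) \<in> clarke_subdiff ramp (g (Inr i) (z $ i))"
    and eq: "(l / \<mu>) *\<^sub>R (\<Sum>i\<in>UNIV.
        (Q (Inl i) * deriv (g (Inl i)) (z $ i) + Q (Inr i) * deriv (g (Inr i)) (z $ i)) *\<^sub>R axis i 1)
      = \<xi> + (l / \<mu>) *\<^sub>R (\<Sum>i\<in>UNIV.
        (a (Inl i) * deriv (g (Inl i)) (z $ i) + a (Inr i) * deriv (g (Inr i)) (z $ i)) *\<^sub>R axis i 1) + w"
    using wd unfolding wd_inclusion_def Q_def by (auto elim!: set_plus_elim)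
  have comp: "(\<Sum>i\<in>UNIV. (f i :: real) *\<^sub>R axis i (1::real)) $ j = f j" for f and j :: 'n
    by (simp add: axis_def if_distrib cong: if_cong)
  show thesis
  proof (rule that[OF \<xi> w, of "\<lambda>k. Q k - a k"])
    fix i
    have "(l / \<mu>) * (Q (Inl i) * deriv (g (Inl i)) (z $ i) + Q (Inr i) * deriv (g (Inr i)) (z $ i))
      = \<xi> $ i + (l / \<mu>) * (a (Inl i) * deriv (g (Inl i)) (z $ i) + a (Inr i) * deriv (g (Inr i)) (z $ i))
        + w $ i"
      using arg_cong[OF eq, of "\<lambda>x. x $ i"]
      by (simp only: vector_add_component vector_scaleR_component comp real_scaleR_def)
    then show "(l / \<mu>) * ((Q (Inl i) - a (Inl i)) * deriv (g (Inl i)) (z $ i)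
          + (Q (Inr i) - a (Inr i)) * deriv (g (Inr i)) (z $ i)) = \<xi> $ i + w $ i"
      by (simp add: algebra_simps)
  next
    fix i and k :: "'n + 'n" assume k: "k \<in> {Inl i, Inr i}"
    then have "q k \<in> active_pieces (g k (z $ i) - \<mu>)" "a k \<in> clarke_subdiff ramp (g k (z $ i))"
      "Q k - a k = deriv (ramp_piece (q k)) (g k (z $ i) - \<mu>) - a k"
      using q a by (auto simp: Q_def)
    note W = ramp_weight[OF this(1,2) \<mu> this(3)]
    show "-1 \<le> Q k - a k \<and> Q k - a k \<le> 0 \<and> (Q k - a k \<noteq> 0 \<longrightarrow> g k (z $ i) \<in> {0..\<mu>}) \<and>
       (0 < g k (z $ i) \<longrightarrow> Q k - a k \<in> {0, -1}) \<and> (g k (z $ i) \<in> {0<..<\<mu>} \<longrightarrow> Q k - a k = -1)"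
      using W by blast
  qed
qed

section \<open>Stationarity excludes intermediate values and gives local optimality\<close>

text \<open>In the critical case \<open>G s = 0\<close>, a point \<open>t\<close> with \<open>G t \<le> 0\<close> satisfies \<open>deriv G s * (t - s) \<le> 0\<close>
  because \<open>G\<close> lies above its tangent, so the linear term is nonnegative; at a point with \<open>G t > 0\<close> the
  count increases by 1, more than the linear term can take away near \<open>s\<close>. If \<open>G s \<noteq> 0\<close>, there
  is no linear term and the count cannot decrease locally.\<close>

lemma pos_part_pow0_jump:
  fixes G :: "real \<Rightarrow> real"
  assumes diff: "G differentiable at s" and cvx: "convex_on UNIV G" and \<mu>: "\<mu> > 0"
    and b: "-1 \<le> b" "b \<le> 0" "b \<noteq> 0 \<Longrightarrow> G s = 0"
  shows "eventually (\<lambda>t. pos_part_pow0 (G s) \<le> pos_part_pow0 (G t) + b / \<mu> * deriv G s * (t - s)) (nhds s)"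
proof -
  have der: "(G has_real_derivative deriv G s) (at s)"
    using diff DERIV_deriv_iff_real_differentiable by blast
  have lim: "(G \<longlongrightarrow> G s) (nhds s)"
    using DERIV_isCont[OF der] by (metis isCont_def tendsto_at_iff_tendsto_nhds)
  consider "G s < 0" | "G s = 0" | "G s > 0" by linarith
  then show ?thesis
  proof cases
    case 1
    then have "b = 0" using b by force
    with 1 show ?thesis by (simp add: pos_part_pow0_def)
  next
    case 2
    have "((\<lambda>t. b / \<mu> * deriv G s * (t - s)) \<longlongrightarrow> b / \<mu> * deriv G s * (s - s)) (nhds s)"
      by (intro tendsto_intros filterlim_ident)
    then have "eventually (\<lambda>t. -1 < b / \<mu> * deriv G s * (t - s)) (nhds s)"
      by (rule order_tendstoD) simp
    then show ?thesis
    proof eventually_elim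
      case (elim t)
      have tangent: "deriv G s * (t - s) \<le> G t"
        using convex_on_imp_above_tangent[OF cvx, of s t "deriv G s"] der 2 by simp
      show ?case
      proof (cases "G t > 0")
        case True
        with elim 2 show ?thesis by (simp add: pos_part_pow0_def)
      next
        case False
        have "0 \<le> b / \<mu> * (deriv G s * (t - s))"
          using False tangent b \<mu> by (intro mult_nonpos_nonpos) (auto simp: divide_nonpos_pos)
        with 2 show ?thesis by (simp add: pos_part_pow0_def mult.assoc)
      qed
    qed
  next
    case 3
    then have "b = 0" using b by force
    have "eventually (\<lambda>t. 0 < G t) (nhds s)"
      using order_tendstoD(1)[OF lim 3] .
    then show ?thesis
      by (rule eventually_mono) (use 3 \<open>b = 0\<close> in \<open>simp add: pos_part_pow0_def\<close>)
  qed
qed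

text \<open>This is the theorem for one block, for minimization of a function \<open>\<phi>\<close> of which \<open>S\<close> collects
  some subgradients. It is applied to \<open>c\<close> in the first variable and to \<open>- c\<close> in the second.\<close>

lemma stationary_block_optimal:
  fixes z :: "real ^ 'n" and g :: "'n + 'n \<Rightarrow> real \<Rightarrow> real"
  assumes g_C1: "\<And>k. g k C1_differentiable_on UNIV"
    and g_convex: "\<And>k. convex_on UNIV (g k)"
    and u_convex: "\<And>t. t \<in> {1..N} \<Longrightarrow> convex_on UNIV (u t)"
    and X_def: "X = feasible_set lo hi N u"
    and int: "interior X \<noteq> {}" and slater: "\<exists>x. \<forall>t\<in>{1..N}. u t x < 0"
    and cond: "structural_condition lo hi N u g \<tau> \<sigma>"
    and S_sub: "S \<subseteq> subgradients \<phi> z" and S_bound: "\<And>\<xi>. \<xi> \<in> S \<Longrightarrow> infnorm \<xi> \<le> L"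
    and L: "L > 0" and l: "l > 0" and \<mu>: "0 < \<mu>" "\<mu> < \<tau>" "\<mu> < l * \<sigma> / L"
    and wd: "wd_inclusion S l \<mu> g X z q"
    and q: "\<And>i. q (Inl i) \<in> active_pieces (g (Inl i) (z $ i) - \<mu>)"
      "\<And>i. q (Inr i) \<in> active_pieces (g (Inr i) (z $ i) - \<mu>)"
  defines "F \<equiv> \<lambda>x. \<phi> x
      + l * (\<Sum>i\<in>UNIV. pos_part_pow0 (g (Inl i) (x $ i)) + pos_part_pow0 (g (Inr i) (x $ i)))"
  shows "g (Inl i) (z $ i) \<notin> {0<..<\<mu>}" "g (Inr i) (z $ i) \<notin> {0<..<\<mu>}"
    and "\<exists>\<delta>>0. \<forall>x\<in>X \<inter> cball z \<delta>. F z \<le> F x"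
proof -
  obtain \<xi> w b where \<xi>: "\<xi> \<in> S" and w: "w \<in> normal_cone X z"
    and eq: "\<And>i. (l / \<mu>) * (b (Inl i) * deriv (g (Inl i)) (z $ i)
        + b (Inr i) * deriv (g (Inr i)) (z $ i)) = \<xi> $ i + w $ i"
    and b: "\<And>i k. k \<in> {Inl i, Inr i} \<Longrightarrow> -1 \<le> b k \<and> b k \<le> 0 \<and>
        (b k \<noteq> 0 \<longrightarrow> g k (z $ i) \<in> {0..\<mu>}) \<and>
        (0 < g k (z $ i) \<longrightarrow> b k \<in> {0, -1}) \<and> (g k (z $ i) \<in> {0<..<\<mu>} \<longrightarrow> b k = -1)"
    by (rule wd_inclusion_componentwise[OF wd \<mu>(1) q]) (rule that)
  have zX: "z \<in> X" using w by (simp add: normal_cone_def)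
  \<comment> \<open>Otherwise the normal component would have to balance
    \<open>(l/\<mu>) g\<^sub>k'\<close>, with a sign that the constraints do not allow.\<close>
  have excl: "b k \<noteq> -1" if k: "(k, k') \<in> {(Inl i, Inr i), (Inr i, Inl i)}" and pos: "g k (z $ i) > 0"
    for k k' i
  proof
    assume bk: "b k = -1"
    have ks: "k \<in> {Inl i, Inr i}" "k' \<in> {Inl i, Inr i}" using k by auto
    \<comment> \<open>Here \<open>g k (z $ i) \<le> \<mu> < \<tau>\<close>, so the structural condition also covers the value \<open>\<mu>\<close>.\<close>
    have gk: "g k (z $ i) \<in> {0<..<\<tau>}"
      using b[OF ks(1)] bk pos \<mu> by auto
    have A: "z $ i \<in> interior {lo $ i..hi $ i}" "g k' (z $ i) \<notin> {0..\<tau>}"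
      "\<bar>deriv (g k) (z $ i)\<bar> \<ge> \<sigma>"
      "\<forall>t\<in>{1..N}. u t z = 0 \<longrightarrow> (\<forall>\<zeta>\<in>clarke_subdiff (u t) z. \<zeta> $ i * deriv (g k) (z $ i) \<ge> 0)"
      using cond[unfolded structural_condition_def, THEN bspec, OF zX[unfolded X_def], THEN spec,
          of i, THEN bspec, OF k, unfolded prod.case, THEN mp, OF gk]
      by blast+
    have "b k' = 0" using b[OF ks(2)] A(2) \<mu>(2) by auto
    then have e: "w $ i = - \<xi> $ i - l / \<mu> * deriv (g k) (z $ i)"
    proof -
      have "b (Inl i) * deriv (g (Inl i)) (z $ i) + b (Inr i) * deriv (g (Inr i)) (z $ i)
          = - deriv (g k) (z $ i)"
        using k bk \<open>b k' = 0\<close> by (elim insertE) (simp_all del: insert_iff)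
      then show ?thesis
        using eq[of i] by simp
    qed
    have "w $ i * deriv (g k) (z $ i) \<ge> 0"
    proof (rule normal_cone_component_sign[OF u_convex int[unfolded X_def] slater w[unfolded X_def] A(1)])
      fix t \<zeta> assume "t \<in> {1..N}" "u t z = 0" "\<zeta> \<in> subgradients (u t) z"
      then show "\<zeta> $ i * deriv (g k) (z $ i) \<ge> 0"
        using A(4) clarke_subdiff_convex[OF u_convex] by blast
    qed
    moreover have "\<bar>\<xi> $ i\<bar> \<le> L"
      using S_bound[OF \<xi>] component_le_infnorm_cart[of \<xi> i] by linarith
    moreover have "L < l / \<mu> * \<sigma>"
      using \<mu> L by (simp add: field_simps)
    then have "L < l / \<mu> * \<bar>deriv (g k) (z $ i)\<bar>"
      using mult_left_mono[OF A(3), of "l / \<mu>"] l \<mu>(1) by simp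
    moreover define D where "D = deriv (g k) (z $ i)"
    ultimately have "w $ i * D \<ge> 0" and lt: "\<bar>\<xi> $ i\<bar> < l / \<mu> * \<bar>D\<bar>"
      by auto
    moreover have "w $ i * D = - (\<xi> $ i * D) - l / \<mu> * \<bar>D\<bar> * \<bar>D\<bar>"
      unfolding e D_def by (simp add: algebra_simps)
    moreover have "\<bar>\<xi> $ i * D\<bar> < l / \<mu> * \<bar>D\<bar> * \<bar>D\<bar>"
      using lt abs_ge_zero[of "\<xi> $ i"] unfolding abs_mult
      by (intro mult_strict_right_mono) (auto simp: zero_less_abs_iff)
    ultimately show False by linarith
  qed
  show "g (Inl i) (z $ i) \<notin> {0<..<\<mu>}" "g (Inr i) (z $ i) \<notin> {0<..<\<mu>}"
    using excl[of "Inl i" "Inr i" i] excl[of "Inr i" "Inl i" i] b[of "Inl i" i] b[of "Inr i" i] by auto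
  have zero: "b k \<noteq> 0 \<Longrightarrow> g k (z $ i) = 0" if "k \<in> {Inl i, Inr i}" for k i
  proof -
    assume "b k \<noteq> 0"
    with b[OF that] have k: "0 \<le> g k (z $ i)" "0 < g k (z $ i) \<Longrightarrow> b k = -1" by auto
    moreover have "0 < g k (z $ i) \<Longrightarrow> b k \<noteq> -1"
      using that excl[of "Inl i" "Inr i" i] excl[of "Inr i" "Inl i" i] by blast
    ultimately show "g k (z $ i) = 0" by fastforce
  qed
  let ?p = "\<lambda>k t. pos_part_pow0 (g k t)"
  let ?d = "\<lambda>k i. b k / \<mu> * deriv (g k) (z $ i)"
  have jump: "eventually (\<lambda>t. ?p k (z $ i) \<le> ?p k t + ?d k i * (t - z $ i)) (nhds (z $ i))"
    if k: "k \<in> {Inl i, Inr i}" for k i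
  proof (rule pos_part_pow0_jump[OF _ g_convex \<mu>(1) _ _ zero[OF k]])
    show "g k differentiable at (z $ i)"
      using g_C1[of k] by (simp add: C1_differentiable_on_eq)
    show "-1 \<le> b k" "b k \<le> 0" using b[OF k] by blast+
  qed
  have "eventually (\<lambda>x. ?p k (z $ i) \<le> ?p k (x $ i) + ?d k i * (x $ i - z $ i)) (nhds z)"
    if k: "k \<in> {Inl i, Inr i}" for k i
    using eventually_compose_filterlim[OF jump[OF k] tendsto_vec_nth[OF filterlim_ident]] .
  then have "eventually (\<lambda>x. \<forall>i. \<forall>k\<in>{Inl i, Inr i}.
      ?p k (z $ i) \<le> ?p k (x $ i) + ?d k i * (x $ i - z $ i)) (nhds z)"
    by (intro eventually_all_finite eventually_ball_finite) auto
  then obtain \<delta> where \<delta>: "\<delta> > 0" "\<And>x i k. dist x z \<le> \<delta> \<Longrightarrow> k \<in> {Inl i, Inr i} \<Longrightarrow>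
      ?p k (z $ i) \<le> ?p k (x $ i) + ?d k i * (x $ i - z $ i)"
    unfolding eventually_nhds_metric_le by blast
  show "\<exists>\<delta>>0. \<forall>x\<in>X \<inter> cball z \<delta>. F z \<le> F x"
  proof (intro exI conjI ballI)
    fix x assume x: "x \<in> X \<inter> cball z \<delta>"
    have "\<phi> z + \<xi> \<bullet> (x - z) \<le> \<phi> x"
      using \<xi> S_sub by (auto simp: subgradients_def)
    moreover have "w \<bullet> (x - z) \<le> 0"
      using w x by (auto simp: normal_cone_def)
    moreover have "\<xi> \<bullet> (x - z) + w \<bullet> (x - z)
        = (\<Sum>i\<in>UNIV. l * ((?d (Inl i) i + ?d (Inr i) i) * (x $ i - z $ i)))"
    proof -
      have "\<xi> \<bullet> (x - z) + w \<bullet> (x - z) = (\<Sum>i\<in>UNIV. (\<xi> $ i + w $ i) * (x $ i - z $ i))"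
        by (simp add: inner_vec_def distrib_right sum.distrib)
      also have "\<dots> = (\<Sum>i\<in>UNIV. l * ((?d (Inl i) i + ?d (Inr i) i) * (x $ i - z $ i)))"
        by (intro sum.cong refl, subst eq[symmetric]) (simp add: algebra_simps add_divide_distrib diff_divide_distrib)
      finally show ?thesis .
    qed
    moreover have "(\<Sum>i\<in>UNIV. l * (?p (Inl i) (z $ i) + ?p (Inr i) (z $ i)))
       \<le> (\<Sum>i\<in>UNIV. l * (?p (Inl i) (x $ i) + ?p (Inr i) (x $ i))
            + l * ((?d (Inl i) i + ?d (Inr i) i) * (x $ i - z $ i)))"
    proof (intro sum_mono)
      fix i
      have "?p (Inl i) (z $ i) \<le> ?p (Inl i) (x $ i) + ?d (Inl i) i * (x $ i - z $ i)"
        "?p (Inr i) (z $ i) \<le> ?p (Inr i) (x $ i) + ?d (Inr i) i * (x $ i - z $ i)"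
        using x by (intro \<delta>(2); simp add: dist_commute)+
      then have "?p (Inl i) (z $ i) + ?p (Inr i) (z $ i)
        \<le> ?p (Inl i) (x $ i) + ?p (Inr i) (x $ i) + (?d (Inl i) i + ?d (Inr i) i) * (x $ i - z $ i)"
        by (simp add: distrib_right)
      then show "l * (?p (Inl i) (z $ i) + ?p (Inr i) (z $ i)) \<le> l * (?p (Inl i) (x $ i) + ?p (Inr i) (x $ i))
            + l * ((?d (Inl i) i + ?d (Inr i) i) * (x $ i - z $ i))"
        using mult_left_mono[OF _ less_imp_le[OF l]] by (fastforce simp only: distrib_left)
    qed
    ultimately show "F z \<le> F x"
      unfolding F_def sum_distrib_left unfolding sum.distrib by linarith
  qed (rule \<delta>(1))
qed

section \<open>Strong local saddle points\<close>

theorem theorem5p2: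
  fixes c :: "real ^ 'n \<Rightarrow> real ^ 'm \<Rightarrow> real"
    and g :: "'n + 'n \<Rightarrow> real \<Rightarrow> real"
    and h :: "'m + 'm \<Rightarrow> real \<Rightarrow> real"
    and ulo uhi :: "real ^ 'n" and vlo vhi :: "real ^ 'm"
    and nbar mbar :: nat
    and u :: "nat \<Rightarrow> real ^ 'n \<Rightarrow> real" and v :: "nat \<Rightarrow> real ^ 'm \<Rightarrow> real"
    and X :: "(real ^ 'n) set" and Y :: "(real ^ 'm) set"
    and lam1 lam2 \<tau> \<sigma> L \<mu> :: real
    and xs :: "real ^ 'n" and ys :: "real ^ 'm"
  assumes c_lipschitz: "\<exists>K. K-lipschitz_on UNIV (\<lambda>(x, y). c x y)"
    and c_convex: "\<And>y. convex_on UNIV (\<lambda>x. c x y)"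
    and c_concave: "\<And>x. concave_on UNIV (\<lambda>y. c x y)"
    and g_C1: "\<And>k. g k C1_differentiable_on UNIV"
    and g_convex: "\<And>k. convex_on UNIV (g k)"
    and h_C1: "\<And>k. h k C1_differentiable_on UNIV"
    and h_convex: "\<And>k. convex_on UNIV (h k)"
    and lambda_pos: "lam1 > 0" "lam2 > 0"
    and u_bounds: "\<And>i. ulo $ i < uhi $ i"
    and v_bounds: "\<And>j. vlo $ j < vhi $ j"
    and u_lipschitz: "\<And>t. t \<in> {1..nbar} \<Longrightarrow> \<exists>K. K-lipschitz_on UNIV (u t)"
    and u_convex: "\<And>t. t \<in> {1..nbar} \<Longrightarrow> convex_on UNIV (u t)"
    and v_lipschitz: "\<And>s. s \<in> {1..mbar} \<Longrightarrow> \<exists>K. K-lipschitz_on UNIV (v s)"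
    and v_convex: "\<And>s. s \<in> {1..mbar} \<Longrightarrow> convex_on UNIV (v s)"
    and X_def: "X = feasible_set ulo uhi nbar u"
    and Y_def: "Y = feasible_set vlo vhi mbar v"
    and X_interior: "interior X \<noteq> {}"
    and Y_interior: "interior Y \<noteq> {}"
    and X_slater: "\<exists>x. \<forall>t\<in>{1..nbar}. u t x < 0"
    and Y_slater: "\<exists>y. \<forall>s\<in>{1..mbar}. v s y < 0"
    and L_pos: "L > 0"
    and L_bound: "\<And>x y. x \<in> X \<Longrightarrow> y \<in> Y \<Longrightarrow>
      set_infnorm (clarke_subdiff (\<lambda>x'. c x' y) x) \<le> ereal L \<and>
      set_infnorm (clarke_subdiff (\<lambda>y'. c x y') y) \<le> ereal L"
    and tau_pos: "\<tau> > 0" and sigma_pos: "\<sigma> > 0"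
    and condition_A_x: "structural_condition ulo uhi nbar u g \<tau> \<sigma>"
    and condition_A_y: "structural_condition vlo vhi mbar v h \<tau> \<sigma>"
    and mu_pos: "0 < \<mu>"
    and mu_less: "\<mu> < min \<tau> (min lam1 lam2 * \<sigma> / L)"
    and stationary: "weak_d_stationary c lam1 lam2 g h X Y \<mu> xs ys"
  shows "strong_local_saddle_point \<mu> c lam1 lam2 g h X Y xs ys"
proof -
  obtain q p where xs: "xs \<in> X" and ys: "ys \<in> Y"
    and q: "\<And>i. q (Inl i) \<in> active_pieces (g (Inl i) (xs $ i) - \<mu>)"
      "\<And>i. q (Inr i) \<in> active_pieces (g (Inr i) (xs $ i) - \<mu>)"
    and p: "\<And>j. p (Inl j) \<in> active_pieces (h (Inl j) (ys $ j) - \<mu>)"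
      "\<And>j. p (Inr j) \<in> active_pieces (h (Inr j) (ys $ j) - \<mu>)"
    and wd_x: "wd_inclusion (clarke_subdiff (\<lambda>x'. c x' ys) xs) lam1 \<mu> g X xs q"
    and wd_y: "wd_inclusion (uminus ` clarke_subdiff (\<lambda>y'. c xs y') ys) lam2 \<mu> h Y ys p"
    using stationary unfolding weak_d_stationary_def by blast
  have bound: "infnorm \<xi> \<le> L" if "\<xi> \<in> S" "set_infnorm S \<le> ereal L"
    for \<xi> :: "real ^ 'k" and S
    using that SUP_upper[OF that(1), of "\<lambda>s. ereal (infnorm s)"]
    unfolding set_infnorm_def by (metis ereal_less_eq(3) order_trans)
  have "min lam1 lam2 * \<sigma> / L \<le> lam1 * \<sigma> / L" "min lam1 lam2 * \<sigma> / L \<le> lam2 * \<sigma> / L"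
    using sigma_pos L_pos by (auto intro!: divide_right_mono mult_right_mono)
  then have mu: "\<mu> < \<tau>" "\<mu> < lam1 * \<sigma> / L" "\<mu> < lam2 * \<sigma> / L"
    using mu_less by auto
  have "clarke_subdiff (\<lambda>x'. c x' ys) xs \<subseteq> subgradients (\<lambda>x'. c x' ys) xs"
    using clarke_subdiff_convex[OF c_convex] by blast
  note optx = stationary_block_optimal[OF g_C1 g_convex u_convex X_def X_interior X_slater
      condition_A_x this bound[OF _ conjunct1[OF L_bound[OF xs ys]]] L_pos lambda_pos(1) mu_pos mu(1,2) wd_x q]
  have "uminus ` clarke_subdiff (\<lambda>y'. c xs y') ys \<subseteq> subgradients (\<lambda>y'. - c xs y') ys"
    using clarke_subdiff_concave[OF c_concave] by blast
  note sub_y = this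
  have bound_y: "infnorm \<eta> \<le> L" if "\<eta> \<in> uminus ` clarke_subdiff (\<lambda>y'. c xs y') ys" for \<eta>
    using that bound[OF _ conjunct2[OF L_bound[OF xs ys]]] by (auto simp: infnorm_neg)
  note opty = stationary_block_optimal[OF h_C1 h_convex v_convex Y_def Y_interior Y_slater
      condition_A_y sub_y bound_y L_pos lambda_pos(2) mu_pos mu(1,3) wd_y p]
  obtain \<delta>x where \<delta>x: "\<delta>x > 0" "\<And>x. x \<in> X \<inter> cball xs \<delta>x \<Longrightarrow>
      objective c lam1 lam2 g h xs ys \<le> objective c lam1 lam2 g h x ys"
    using optx(3) unfolding objective_def by auto
  obtain \<delta>y where \<delta>y: "\<delta>y > 0" "\<And>y. y \<in> Y \<inter> cball ys \<delta>y \<Longrightarrow>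
      objective c lam1 lam2 g h xs y \<le> objective c lam1 lam2 g h xs ys"
    using opty(3) unfolding objective_def by (auto simp: algebra_simps)
  have "local_saddle_point (objective c lam1 lam2 g h) X Y xs ys"
    unfolding local_saddle_point_def
    using xs ys \<delta>x \<delta>y by (intro conjI exI[of _ "min \<delta>x \<delta>y"]) auto
  then show ?thesis
    unfolding strong_local_saddle_point_def using optx(1,2) opty(1,2) by blast
qed

end
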